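(* Let $c(x,y)=|x-y|^2$ on $\mathbb{R}$ and $\varepsilon>0$. Consider a path $(v_t)_t$ in $(0,\infty)$ that is differentiable around $t=0$, and denote by $\dot v_t$ its derivative at $t$. Identifying the Gaussian distribution $\mathcal{N}(0,v_t)$ with its variance $v_t$ and writing $v=v_0$, $\dot v=\dot v_0$, the metric tensor reads $$\mathbf{g}_v(\dot v,\dot v)=g(v)\,\dot v^2\quad\text{with}\quad g(v)=\frac{1}{4\sqrt{\frac{\varepsilon^2}{16}+v^2}} .$$
   Context: $\mathrm{OT}_\varepsilon(\mu,\nu)=\inf_{\pi\in\Pi(\mu,\nu)}\iint c\,d\pi+\varepsilon\,\mathrm{KL}(\pi\,|\,\mu\otimes\nu)$, where $\Pi(\mu,\nu)$ is the set of couplings of $\mu,\nu$ and $\mathrm{KL}$ is the Kullback--Leibler divergence. The metric tensor is the second-order term of the Sinkhorn divergence $S_\varepsilon(\mu,\nu)=\mathrm{OT}_\varepsilon(\mu,\nu)-\frac12\mathrm{OT}_\varepsilon(\mu,\mu)-\frac12\mathrm{OT}_\varepsilon(\nu,\nu)$ on the diagonal; along the path of Gaussians $\mathcal{N}(0,v_t)$ (centered, variance $v_t$) it is $$\mathbf{g}_v(\dot v,\dot v)=-\frac12\,\partial_t\partial_s\,\mathrm{OT}_\varepsilon\big(\mathcal{N}(0,v_t),\mathcal{N}(0,v_s)\big)\Big|_{t=s=0}.$$ *)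

theory Defs
  imports "HOL-Probability.Probability"
begin

definition couplings :: "'a measure \<Rightarrow> 'b measure \<Rightarrow> ('a \<times> 'b) measure set" where
  "couplings \<mu> \<nu> =
    {\<pi>. sets \<pi> = sets (\<mu> \<Otimes>\<^sub>M \<nu>) \<and> distr \<pi> \<mu> fst = \<mu> \<and> distr \<pi> \<nu> snd = \<nu>}"

text \<open>
  \<open>KL(\<pi> | \<rho>)\<close> for probability measures, with natural logarithm.  The library's real-valued
  \<^const>\<open>KL_divergence\<close> takes the reference measure as its first measure argument and is
  meaningless unless \<open>\<pi>\<close> is absolutely continuous with respect to \<open>\<rho>\<close> and the log-density is
  \<open>\<pi>\<close>-integrable.  The negative part of the log-density is always \<open>\<pi>\<close>-integrable, so
  \<open>\<infinity>\<close> is the right value in the remaining cases.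
\<close>

definition KL :: "'a measure \<Rightarrow> 'a measure \<Rightarrow> ereal" where
  "KL \<pi> \<rho> =
    (if absolutely_continuous \<rho> \<pi> \<and> integrable \<pi> (entropy_density (exp 1) \<rho> \<pi>)
     then ereal (KL_divergence (exp 1) \<rho> \<pi>) else \<infinity>)"

definition OT :: "('a \<Rightarrow> 'b \<Rightarrow> ennreal) \<Rightarrow> real \<Rightarrow> 'a measure \<Rightarrow> 'b measure \<Rightarrow> ereal" where
  "OT c \<epsilon> \<mu> \<nu> =
    (INF \<pi> \<in> couplings \<mu> \<nu>.
      enn2ereal (\<integral>\<^sup>+ (x, y). c x y \<partial>\<pi>) + ereal \<epsilon> * KL \<pi> (\<mu> \<Otimes>\<^sub>M \<nu>))"

definition sq_cost :: "real \<Rightarrow> real \<Rightarrow> ennreal" where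
  "sq_cost x y = ennreal (\<bar>x - y\<bar>\<^sup>2)"

text \<open>The centered Gaussian with variance \<open>a\<close>; \<^const>\<open>normal_density\<close> takes the standard deviation.\<close>

definition gaussian :: "real \<Rightarrow> real measure" where
  "gaussian a = density lborel (\<lambda>x. ennreal (normal_density 0 (sqrt a) x))"

text \<open>
  The passage to \<^typ>\<open>real\<close> loses nothing for positive variances, see \<open>OT_gaussian_finite\<close> below.
\<close>

definition OT_gaussian :: "real \<Rightarrow> real \<Rightarrow> real \<Rightarrow> real" where
  "OT_gaussian \<epsilon> a b = real_of_ereal (OT sq_cost \<epsilon> (gaussian a) (gaussian b))"

definition metric_tensor :: "real \<Rightarrow> (real \<Rightarrow> real) \<Rightarrow> real" where
  "metric_tensor \<epsilon> v =
    - (1 / 2) * deriv (\<lambda>t. deriv (\<lambda>s. OT_gaussian \<epsilon> (v t) (v s)) 0) 0"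

lemma prob_space_gaussian: "a > 0 \<Longrightarrow> prob_space (gaussian a)"
  unfolding gaussian_def by (rule prob_space_normal_density) simp

lemma sets_gaussian [simp, measurable_cong]: "sets (gaussian a) = sets borel"
  by (simp add: gaussian_def)

lemma space_gaussian [simp]: "space (gaussian a) = UNIV"
  by (simp add: gaussian_def)

lemma KL_nonneg:
  assumes "prob_space \<pi>" "prob_space \<rho>" "sets \<pi> = sets \<rho>"
  shows "0 \<le> KL \<pi> \<rho>"
proof (cases "absolutely_continuous \<rho> \<pi> \<and> integrable \<pi> (entropy_density (exp 1) \<rho> \<pi>)")
  case True
  interpret P: prob_space \<pi> by fact
  interpret R: prob_space \<rho> by fact
  interpret I: information_space \<rho> "exp 1" by standard simp
  have ac: "absolutely_continuous \<rho> \<pi>" and int: "integrable \<pi> (entropy_density (exp 1) \<rho> \<pi>)"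
    using True by auto
  obtain D where D: "D \<in> borel_measurable \<rho>" "AE x in \<rho>. RN_deriv \<rho> \<pi> x = ennreal (D x)"
      "AE x in \<pi>. 0 < D x" "\<And>x. 0 \<le> D x"
    using R.real_RN_deriv[OF P.finite_measure_axioms ac assms(3)] by metis
  note [measurable] = D(1)
  have eq: "density \<rho> D = \<pi>"
  proof -
    have "density \<rho> D = density \<rho> (RN_deriv \<rho> \<pi>)"
      by (rule density_cong) (use D(2) in \<open>auto elim!: eventually_mono\<close>)
    also have "\<dots> = \<pi>" by (rule R.density_RN_deriv[OF ac assms(3)])
    finally show ?thesis .
  qed
  have "AE x in \<rho>. D x * entropy_density (exp 1) \<rho> \<pi> x = D x * log (exp 1) (D x)"
    using D(2) by eventually_elim (simp add: entropy_density_def D(4))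
  moreover have "integrable (density \<rho> D) (entropy_density (exp 1) \<rho> \<pi>)"
    using int eq by simp
  then have "integrable \<rho> (\<lambda>x. D x * entropy_density (exp 1) \<rho> \<pi> x)"
    by (subst (asm) integrable_density) (auto simp: D(4))
  ultimately have "integrable \<rho> (\<lambda>x. D x * log (exp 1) (D x))"
    by (subst (asm) integrable_cong_AE) auto
  moreover have "prob_space (density \<rho> D)" using assms(1) eq by simp
  ultimately have "0 \<le> KL_divergence (exp 1) \<rho> (density \<rho> D)"
    by (intro I.KL_nonneg) (auto simp: D)
  then show ?thesis using True eq by (simp add: KL_def)
qed (auto simp: KL_def)

lemma KL_same: "prob_space \<rho> \<Longrightarrow> KL \<rho> \<rho> = 0"
proof -
  assume "prob_space \<rho>"
  then interpret R: prob_space \<rho> .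
  have ac: "absolutely_continuous \<rho> \<rho>" by (simp add: absolutely_continuous_def)
  have "AE x in \<rho>. (1::ennreal) = RN_deriv \<rho> \<rho> x"
    by (rule R.RN_deriv_unique) (auto simp: density_1)
  then have "AE x in \<rho>. entropy_density (exp 1) \<rho> \<rho> x = 0"
    by (auto simp: entropy_density_def elim!: eventually_mono)
  then have "integrable \<rho> (entropy_density (exp 1) \<rho> \<rho>) \<longleftrightarrow> integrable \<rho> (\<lambda>x. 0::real)"
    by (intro integrable_cong_AE) auto
  then show ?thesis using ac R.KL_same_eq_0 by (simp add: KL_def)
qed

lemma nn_integral_gaussian_sq_finite:
  assumes "a > 0" shows "(\<integral>\<^sup>+ x. ennreal (x\<^sup>2) \<partial>gaussian a) < \<infinity>"
proof -
  have i: "integrable lborel (\<lambda>x. normal_density 0 (sqrt a) x * (x - 0)^2)"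
    by (rule integrable_normal_moment) (simp add: assms)
  have "(\<integral>\<^sup>+ x. ennreal (x\<^sup>2) \<partial>gaussian a) =
      (\<integral>\<^sup>+ x. ennreal (normal_density 0 (sqrt a) x * (x - 0)^2) \<partial>lborel)"
    unfolding gaussian_def by (subst nn_integral_density) (auto simp: ennreal_mult)
  also have "\<dots> < \<infinity>"
    using integrableD(2)[OF i] by (simp add: less_top abs_mult)
  finally show ?thesis .
qed

lemma product_in_couplings:
  assumes "prob_space \<mu>" "prob_space \<nu>"
  shows "\<mu> \<Otimes>\<^sub>M \<nu> \<in> couplings \<mu> \<nu>"
proof -
  interpret M: prob_space \<mu> by fact
  interpret N: prob_space \<nu> by fact
  interpret pair_prob_space \<mu> \<nu> ..
  have "distr (\<mu> \<Otimes>\<^sub>M \<nu>) \<nu> snd = \<nu>"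
  proof (rule measure_eqI)
    fix A assume "A \<in> sets (distr (\<mu> \<Otimes>\<^sub>M \<nu>) \<nu> snd)"
    then have A: "A \<in> sets \<nu>" by simp
    have "snd -` A \<inter> space (\<mu> \<Otimes>\<^sub>M \<nu>) = space \<mu> \<times> A"
      using sets.sets_into_space[OF A] by (auto simp: space_pair_measure)
    then show "emeasure (distr (\<mu> \<Otimes>\<^sub>M \<nu>) \<nu> snd) A = emeasure \<nu> A"
      using A by (simp add: emeasure_distr N.emeasure_pair_measure_Times M.emeasure_space_1)
  qed simp
  moreover have "distr (\<mu> \<Otimes>\<^sub>M \<nu>) \<mu> fst = \<mu>"
  proof (rule measure_eqI)
    fix A assume "A \<in> sets (distr (\<mu> \<Otimes>\<^sub>M \<nu>) \<mu> fst)"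
    then have A: "A \<in> sets \<mu>" by simp
    have "fst -` A \<inter> space (\<mu> \<Otimes>\<^sub>M \<nu>) = A \<times> space \<nu>"
      using sets.sets_into_space[OF A] by (auto simp: space_pair_measure)
    then show "emeasure (distr (\<mu> \<Otimes>\<^sub>M \<nu>) \<mu> fst) A = emeasure \<mu> A"
      using A by (simp add: emeasure_distr N.emeasure_pair_measure_Times N.emeasure_space_1)
  qed simp
  ultimately show ?thesis by (simp add: couplings_def)
qed

lemma prob_space_coupling:
  assumes "prob_space \<mu>" "\<pi> \<in> couplings \<mu> \<nu>"
  shows "prob_space \<pi>"
proof -
  have s: "sets \<pi> = sets (\<mu> \<Otimes>\<^sub>M \<nu>)" and d: "distr \<pi> \<mu> fst = \<mu>"
    using assms(2) by (auto simp: couplings_def)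
  have "fst \<in> measurable \<pi> \<mu>"
    using measurable_cong_sets[OF s refl] measurable_fst by blast
  then show ?thesis using prob_space_distrD[of fst \<pi> \<mu>] assms(1) d by simp
qed

theorem OT_gaussian_finite:
  assumes "\<epsilon> > 0" "a > 0" "b > 0"
  shows "\<bar>OT sq_cost \<epsilon> (gaussian a) (gaussian b)\<bar> \<noteq> \<infinity>"
proof -
  let ?A = "gaussian a" and ?B = "gaussian b"
  let ?P = "?A \<Otimes>\<^sub>M ?B"
  interpret A: prob_space ?A by (rule prob_space_gaussian) fact
  interpret B: prob_space ?B by (rule prob_space_gaussian) fact
  interpret P: pair_prob_space ?A ?B ..
  have P: "prob_space ?P" by (rule P.prob_space_axioms)
  have "0 \<le> OT sq_cost \<epsilon> ?A ?B"
    unfolding OT_def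
  proof (rule INF_greatest)
    fix \<pi> assume \<pi>: "\<pi> \<in> couplings ?A ?B"
    have "0 \<le> KL \<pi> ?P"
      using prob_space_coupling[OF A.prob_space_axioms \<pi>] P \<pi>
      by (intro KL_nonneg) (auto simp: couplings_def)
    then show "0 \<le> enn2ereal (\<integral>\<^sup>+ (x, y). sq_cost x y \<partial>\<pi>) + ereal \<epsilon> * KL \<pi> ?P"
      using assms(1) by (intro add_nonneg_nonneg) auto
  qed
  moreover have "OT sq_cost \<epsilon> ?A ?B < \<infinity>"
  proof -
    have prod: "?P \<in> couplings ?A ?B"
      by (rule product_in_couplings) unfold_locales
    then have d: "distr ?P ?A fst = ?A" "distr ?P ?B snd = ?B"
      by (auto simp: couplings_def)
    have x: "(\<integral>\<^sup>+ z. ennreal ((fst z)\<^sup>2) \<partial>?P) = (\<integral>\<^sup>+ x. ennreal (x\<^sup>2) \<partial>?A)"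
      by (subst (2) d(1)[symmetric], subst nn_integral_distr) auto
    have y: "(\<integral>\<^sup>+ z. ennreal ((snd z)\<^sup>2) \<partial>?P) = (\<integral>\<^sup>+ x. ennreal (x\<^sup>2) \<partial>?B)"
      by (subst (2) d(2)[symmetric], subst nn_integral_distr) auto
    have "sq_cost x y \<le> 2 * ennreal (x\<^sup>2) + 2 * ennreal (y\<^sup>2)" for x y
    proof -
      have "0 \<le> (x + y)\<^sup>2" by simp
      then have "\<bar>x - y\<bar>\<^sup>2 \<le> 2 * x\<^sup>2 + 2 * y\<^sup>2"
        by (simp add: power2_eq_square algebra_simps)
      then have "ennreal (\<bar>x - y\<bar>\<^sup>2) \<le> ennreal (2 * x\<^sup>2 + 2 * y\<^sup>2)"
        by (rule ennreal_leI)
      also have "\<dots> = 2 * ennreal (x\<^sup>2) + 2 * ennreal (y\<^sup>2)"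
        by (simp add: ennreal_mult)
      finally show ?thesis by (simp add: sq_cost_def)
    qed
    then have "(\<integral>\<^sup>+ (x, y). sq_cost x y \<partial>?P)
        \<le> (\<integral>\<^sup>+ z. 2 * ennreal ((fst z)\<^sup>2) + 2 * ennreal ((snd z)\<^sup>2) \<partial>?P)"
      by (intro nn_integral_mono) (auto simp: split_beta)
    also have "\<dots> = 2 * (\<integral>\<^sup>+ z. ennreal ((fst z)\<^sup>2) \<partial>?P) + 2 * (\<integral>\<^sup>+ z. ennreal ((snd z)\<^sup>2) \<partial>?P)"
      by (simp add: nn_integral_add nn_integral_cmult)
    also have "\<dots> < \<infinity>"
      unfolding x y using nn_integral_gaussian_sq_finite assms
      by (auto simp: ennreal_mult_less_top less_top)
    finally have fin: "enn2ereal (\<integral>\<^sup>+ (x, y). sq_cost x y \<partial>?P) < \<infinity>"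
      by (metis enn2ereal_top infinity_ennreal_def less_ennreal.rep_eq)
    have "OT sq_cost \<epsilon> ?A ?B
        \<le> enn2ereal (\<integral>\<^sup>+ (x, y). sq_cost x y \<partial>?P) + ereal \<epsilon> * KL ?P ?P"
      unfolding OT_def by (rule INF_lower[OF prod])
    also have "\<dots> = enn2ereal (\<integral>\<^sup>+ (x, y). sq_cost x y \<partial>?P)"
      by (simp add: KL_same[OF P])
    also note fin
    finally show ?thesis .
  qed
  ultimately show ?thesis by auto
qed

end

theory Submission
  imports Defs
begin

text \<open>
  If the density \<open>exp ((f x + g y - c x y) / \<epsilon>)\<close> has both marginals right, then by Gibbs'
  inequality it is the optimal plan, with value \<open>\<integral>f d\<mu> + \<integral>g d\<nu>\<close>.  For Gaussians the potentials are
  quadratic, which gives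
  \<open>OT\<^sub>\<epsilon> = a + b - 2\<kappa> - (\<epsilon>/2) ln (\<epsilon>\<kappa> / (2ab))\<close> with \<open>\<kappa>\<close> the covariance of the optimal plan, the
  positive root of \<open>\<kappa>\<^sup>2 + \<epsilon>\<kappa>/2 = ab\<close>.  By the envelope theorem the derivative in \<open>b\<close> is \<open>1 - \<kappa>/b\<close>.
\<close>

section \<open>Gibbs' inequality\<close>

text \<open>With D the density of \<pi> with respect to \<rho>, integrate
  \<open>ln u \<le> u - 1\<close> at u = exp \<phi> / D against \<pi>. The left side becomes the
  integral of \<phi> minus the divergence. The right side is at most 0, since the \<pi>-integral of
  exp \<phi> / D is at most the \<rho>-integral of exp \<phi>. An infinite divergence leaves nothing
  to prove.\<close>

lemma KL_ge_integral:
  fixes \<phi> :: "'a \<Rightarrow> real"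
  assumes "prob_space \<pi>" "prob_space \<rho>" "sets \<pi> = sets \<rho>"
    and \<phi>: "integrable \<pi> \<phi>" and le1: "(\<integral>\<^sup>+ x. ennreal (exp (\<phi> x)) \<partial>\<rho>) \<le> 1"
  shows "ereal (integral\<^sup>L \<pi> \<phi>) \<le> KL \<pi> \<rho>"
proof (cases "absolutely_continuous \<rho> \<pi> \<and> integrable \<pi> (entropy_density (exp 1) \<rho> \<pi>)")
  case True
  interpret P: prob_space \<pi> by fact
  interpret R: prob_space \<rho> by fact
  have ac: "absolutely_continuous \<rho> \<pi>" and int: "integrable \<pi> (entropy_density (exp 1) \<rho> \<pi>)"
    using True by auto
  obtain D where D: "D \<in> borel_measurable \<rho>" "AE x in \<rho>. RN_deriv \<rho> \<pi> x = ennreal (D x)"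
      "AE x in \<pi>. 0 < D x" "\<And>x. 0 \<le> D x"
    using R.real_RN_deriv[OF P.finite_measure_axioms ac assms(3)] by metis
  note [measurable] = D(1)
  have [measurable]: "\<phi> \<in> borel_measurable \<rho>"
    using borel_measurable_integrable[OF \<phi>] assms(3) by (simp cong: measurable_cong_sets)
  have eq: "density \<rho> D = \<pi>"
  proof -
    have "density \<rho> D = density \<rho> (RN_deriv \<rho> \<pi>)"
      by (rule density_cong) (use D(2) in \<open>auto elim!: eventually_mono\<close>)
    also have "\<dots> = \<pi>" by (rule R.density_RN_deriv[OF ac assms(3)])
    finally show ?thesis .
  qed
  have meas: "(\<lambda>x. exp (\<phi> x) / D x) \<in> borel_measurable \<pi>"
    using assms(3) by (simp cong: measurable_cong_sets)
  have "(\<integral>\<^sup>+ x. ennreal (exp (\<phi> x) / D x) \<partial>\<pi>)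
      = (\<integral>\<^sup>+ x. ennreal (D x) * ennreal (exp (\<phi> x) / D x) \<partial>\<rho>)"
    by (subst eq[symmetric], subst nn_integral_density) auto
  \<comment> \<open>In general only an inequality: where D vanishes the left integrand is 0, while
    exp \<phi> stays positive.\<close>
  also have "\<dots> \<le> (\<integral>\<^sup>+ x. ennreal (exp (\<phi> x)) \<partial>\<rho>)"
    by (intro nn_integral_mono) (auto simp: D(4) ennreal_mult[symmetric])
  finally have le: "(\<integral>\<^sup>+ x. ennreal (exp (\<phi> x) / D x) \<partial>\<pi>) \<le> 1" using le1 by simp
  have iq: "integrable \<pi> (\<lambda>x. exp (\<phi> x) / D x)"
    by (rule integrableI_nonneg) (use meas le D(4) in \<open>auto intro: le_less_trans\<close>)
  have "ennreal (\<integral>x. exp (\<phi> x) / D x \<partial>\<pi>) \<le> 1"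
    using le by (subst nn_integral_eq_integral[symmetric]) (auto simp: iq D(4))
  then have le': "(\<integral>x. exp (\<phi> x) / D x \<partial>\<pi>) \<le> 1"
    by (simp add: ennreal_le_1)
  have "AE x in \<pi>. RN_deriv \<rho> \<pi> x = ennreal (D x)"
    by (rule absolutely_continuous_AE[OF assms(3) ac D(2)])
  then have "AE x in \<pi>. \<phi> x - entropy_density (exp 1) \<rho> \<pi> x \<le> exp (\<phi> x) / D x - 1"
    using D(3)
  proof eventually_elim
    case (elim x)
    then have "\<phi> x - ln (D x) = ln (exp (\<phi> x) / D x)"
      by (simp add: ln_div)
    also have "\<dots> \<le> exp (\<phi> x) / D x - 1"
      using elim by (intro ln_le_minus_one) simp
    finally show ?case using elim by (simp add: entropy_density_def log_def)
  qed
  then have "(\<integral>x. \<phi> x - entropy_density (exp 1) \<rho> \<pi> x \<partial>\<pi>) \<le> (\<integral>x. exp (\<phi> x) / D x - 1 \<partial>\<pi>)"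
    by (intro integral_mono_AE) (auto simp: iq \<phi> int)
  also have "\<dots> \<le> 0" using le' by (simp add: iq P.prob_space)
  finally show ?thesis
    using True by (simp add: KL_def KL_divergence_def \<phi> int)
qed (auto simp: KL_def)

text \<open>The equality case of Gibbs' inequality: by uniqueness of the Radon-Nikodym derivative
  the log-density is \<phi> almost everywhere. Integrability of \<phi> selects the finite branch of
  \<open>KL\<close>.\<close>

lemma KL_density_exp:
  fixes \<phi> :: "'a \<Rightarrow> real"
  assumes "prob_space \<rho>" and [measurable]: "\<phi> \<in> borel_measurable \<rho>"
    and \<phi>: "integrable (density \<rho> (\<lambda>x. ennreal (exp (\<phi> x)))) \<phi>"
  shows "KL (density \<rho> (\<lambda>x. ennreal (exp (\<phi> x)))) \<rho>
    = ereal (integral\<^sup>L (density \<rho> (\<lambda>x. ennreal (exp (\<phi> x)))) \<phi>)"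
proof -
  interpret R: prob_space \<rho> by fact
  let ?p = "density \<rho> (\<lambda>x. ennreal (exp (\<phi> x)))"
  have ac: "absolutely_continuous \<rho> ?p"
    by (rule absolutely_continuousI_density) simp
  have "AE x in \<rho>. ennreal (exp (\<phi> x)) = RN_deriv \<rho> ?p x"
    by (rule R.RN_deriv_unique) auto
  then have "AE x in ?p. ennreal (exp (\<phi> x)) = RN_deriv \<rho> ?p x"
    by (intro absolutely_continuous_AE[OF _ ac]) auto
  then have ae: "AE x in ?p. entropy_density (exp 1) \<rho> ?p x = \<phi> x"
  proof eventually_elim
    case (elim x)
    show ?case by (simp add: entropy_density_def elim[symmetric] log_def)
  qed
  have m: "entropy_density (exp 1) \<rho> ?p \<in> borel_measurable ?p" by simp
  have "integrable ?p (entropy_density (exp 1) \<rho> ?p)"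
    using \<phi> by (subst integrable_cong_AE[OF m _ ae]) auto
  moreover have "KL_divergence (exp 1) \<rho> ?p = integral\<^sup>L ?p \<phi>"
    unfolding KL_divergence_def by (rule integral_cong_AE[OF m _ ae]) simp
  ultimately show ?thesis using ac by (simp add: KL_def)
qed

section \<open>Optimality of Schroedinger potentials\<close>

lemma coupling_marginals:
  assumes "\<pi> \<in> couplings M N"
  shows "fst \<in> measurable \<pi> M" "snd \<in> measurable \<pi> N"
    "distr \<pi> M fst = M" "distr \<pi> N snd = N"
proof -
  have s: "sets \<pi> = sets (M \<Otimes>\<^sub>M N)" using assms by (simp add: couplings_def)
  show "fst \<in> measurable \<pi> M" "snd \<in> measurable \<pi> N"
    by (simp_all cong: measurable_cong_sets add: s)
  show "distr \<pi> M fst = M" "distr \<pi> N snd = N" using assms by (simp_all add: couplings_def)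
qed

text \<open>A change of variables along the projection. This and its counterpart for
  \<open>snd\<close> make the potentials contribute the same amount under every coupling.\<close>

lemma coupling_integral_fst:
  fixes f :: "'a \<Rightarrow> real"
  assumes "\<pi> \<in> couplings M N" "integrable M f"
  shows "integrable \<pi> (\<lambda>z. f (fst z))" "(\<integral>z. f (fst z) \<partial>\<pi>) = integral\<^sup>L M f"
  using assms coupling_marginals[OF assms(1)]
  by (metis integrable_distr, metis integral_distr borel_measurable_integrable)

lemma coupling_integral_snd:
  fixes g :: "'b \<Rightarrow> real"
  assumes "\<pi> \<in> couplings M N" "integrable N g"
  shows "integrable \<pi> (\<lambda>z. g (snd z))" "(\<integral>z. g (snd z) \<partial>\<pi>) = integral\<^sup>L N g"
  using assms coupling_marginals[OF assms(1)]
  by (metis integrable_distr, metis integral_distr borel_measurable_integrable)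

text \<open>Test a marginal on a set A: by Fubini the indicator of A leaves the inner integral, and
  what remains inside is 1.\<close>

lemma density_in_couplings:
  fixes D :: "'a \<times> 'b \<Rightarrow> ennreal"
  assumes "prob_space M" "prob_space N"
    and [measurable]: "D \<in> borel_measurable (M \<Otimes>\<^sub>M N)"
    and 1: "\<And>x. x \<in> space M \<Longrightarrow> (\<integral>\<^sup>+ y. D (x, y) \<partial>N) = 1"
    and 2: "\<And>y. y \<in> space N \<Longrightarrow> (\<integral>\<^sup>+ x. D (x, y) \<partial>M) = 1"
  shows "density (M \<Otimes>\<^sub>M N) D \<in> couplings M N"
proof -
  interpret M: prob_space M by fact
  interpret N: prob_space N by fact
  interpret pair_sigma_finite M N ..
  let ?p = "density (M \<Otimes>\<^sub>M N) D"
  have "distr ?p M fst = M"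
  proof (rule measure_eqI)
    fix A assume "A \<in> sets (distr ?p M fst)"
    then have [measurable]: "A \<in> sets M" by simp
    have "emeasure (distr ?p M fst) A = (\<integral>\<^sup>+ z. indicator A z \<partial>distr ?p M fst)" by simp
    also have "\<dots> = (\<integral>\<^sup>+ z. D z * indicator A (fst z) \<partial>(M \<Otimes>\<^sub>M N))"
      by (subst nn_integral_distr) (auto simp: nn_integral_density)
    also have "\<dots> = (\<integral>\<^sup>+ x. (\<integral>\<^sup>+ y. D (x, y) \<partial>N) * indicator A x \<partial>M)"
      by (subst N.nn_integral_fst[symmetric]) (auto intro!: nn_integral_cong nn_integral_multc)
    also have "\<dots> = (\<integral>\<^sup>+ x. indicator A x \<partial>M)"
      by (intro nn_integral_cong) (simp add: 1)
    finally show "emeasure (distr ?p M fst) A = emeasure M A" by simp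
  qed simp
  moreover have "distr ?p N snd = N"
  proof (rule measure_eqI)
    fix A assume "A \<in> sets (distr ?p N snd)"
    then have [measurable]: "A \<in> sets N" by simp
    have "emeasure (distr ?p N snd) A = (\<integral>\<^sup>+ z. indicator A z \<partial>distr ?p N snd)" by simp
    also have "\<dots> = (\<integral>\<^sup>+ z. D z * indicator A (snd z) \<partial>(M \<Otimes>\<^sub>M N))"
      by (subst nn_integral_distr) (auto simp: nn_integral_density)
    also have "\<dots> = (\<integral>\<^sup>+ y. (\<integral>\<^sup>+ x. D (x, y) \<partial>M) * indicator A y \<partial>N)"
      by (subst nn_integral_snd[symmetric]) (auto intro!: nn_integral_cong nn_integral_multc)
    also have "\<dots> = (\<integral>\<^sup>+ y. indicator A y \<partial>N)"
      by (intro nn_integral_cong) (simp add: 2)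
    finally show "emeasure (distr ?p N snd) A = emeasure N A" by simp
  qed simp
  ultimately show ?thesis by (simp add: couplings_def)
qed

text \<open>Since C + \<epsilon>\<phi> = f + g, every coupling with integrable cost gives C +
  \<epsilon>\<phi> the same integral, fixed by the marginals. Replacing \<epsilon> times the
  integral of \<phi> by \<epsilon> times the divergence can only increase the value, and changes
  nothing for the plan with density exp \<phi>.\<close>

theorem OT_eq_potentials:
  fixes c :: "'a \<Rightarrow> 'b \<Rightarrow> real"
  assumes "prob_space M" "prob_space N" and \<epsilon>: "\<epsilon> > 0"
    and cm [measurable]: "case_prod c \<in> borel_measurable (M \<Otimes>\<^sub>M N)" and c0: "\<And>x y. 0 \<le> c x y"
    and f: "integrable M f" and g: "integrable N g"
    and 1: "\<And>x. x \<in> space M \<Longrightarrow> (\<integral>\<^sup>+ y. ennreal (exp ((f x + g y - c x y) / \<epsilon>)) \<partial>N) = 1"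
    and 2: "\<And>y. y \<in> space N \<Longrightarrow> (\<integral>\<^sup>+ x. ennreal (exp ((f x + g y - c x y) / \<epsilon>)) \<partial>M) = 1"
  shows "OT (\<lambda>x y. ennreal (c x y)) \<epsilon> M N = ereal (integral\<^sup>L M f + integral\<^sup>L N g)"
proof -
  interpret M: prob_space M by fact
  interpret N: prob_space N by fact
  interpret pair_prob_space M N ..
  note [measurable] = borel_measurable_integrable[OF f] borel_measurable_integrable[OF g]
  let ?R = "M \<Otimes>\<^sub>M N"
  define C where "C z = c (fst z) (snd z)" for z
  define \<phi> where "\<phi> z = (f (fst z) + g (snd z) - C z) / \<epsilon>" for z
  have [measurable]: "C \<in> borel_measurable ?R"
    using cm by (simp add: C_def[abs_def] split_beta')
  have [measurable]: "\<phi> \<in> borel_measurable ?R" by (simp add: \<phi>_def[abs_def])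
  define p where "p = density ?R (\<lambda>z. ennreal (exp (\<phi> z)))"
  have p: "p \<in> couplings M N" unfolding p_def
    by (rule density_in_couplings) (use assms in \<open>auto simp: \<phi>_def C_def\<close>)
  \<comment> \<open>The normalization that Gibbs' inequality asks for; it holds because the
    candidate plan \<open>p\<close> is a coupling of probability measures.\<close>
  have one: "(\<integral>\<^sup>+ z. ennreal (exp (\<phi> z)) \<partial>?R) = 1"
    using prob_space.emeasure_space_1[OF prob_space_coupling[OF M.prob_space_axioms p]]
    by (simp add: p_def emeasure_density cong: nn_integral_cong)
  have C_eq: "C z = f (fst z) + g (snd z) - \<epsilon> * \<phi> z" for z
    using \<epsilon> by (simp add: \<phi>_def)
  have val: "enn2ereal (\<integral>\<^sup>+ (x, y). ennreal (c x y) \<partial>\<pi>) = ereal (integral\<^sup>L \<pi> C)"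
    if "integrable \<pi> C" for \<pi>
    using nn_integral_eq_integral[OF that] c0
    by (simp add: C_def split_beta' enn2ereal_ennreal)
  have int\<phi>: "integrable \<pi> \<phi>" and tot: "integral\<^sup>L \<pi> C + \<epsilon> * integral\<^sup>L \<pi> \<phi>
      = integral\<^sup>L M f + integral\<^sup>L N g"
    if \<pi>: "\<pi> \<in> couplings M N" and C: "integrable \<pi> C" for \<pi>
  proof -
    note i = coupling_integral_fst[OF \<pi> f] coupling_integral_snd[OF \<pi> g]
    show "integrable \<pi> \<phi>" unfolding \<phi>_def using i C by auto
    have "\<epsilon> * integral\<^sup>L \<pi> \<phi> = (\<integral>z. \<epsilon> * \<phi> z \<partial>\<pi>)" by simp
    also have "\<dots> = (\<integral>z. f (fst z) + g (snd z) - C z \<partial>\<pi>)"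
      using \<epsilon> by (simp add: \<phi>_def)
    also have "\<dots> = integral\<^sup>L M f + integral\<^sup>L N g - integral\<^sup>L \<pi> C"
      using i C by simp
    finally show "integral\<^sup>L \<pi> C + \<epsilon> * integral\<^sup>L \<pi> \<phi> = integral\<^sup>L M f + integral\<^sup>L N g" by simp
  qed
  show ?thesis
  proof (rule antisym)
    \<comment> \<open>Both \<open>tot\<close> and the divergence formula for \<open>p\<close> rest
      on this. As 0 \<le> C = f + g - \<epsilon>\<phi>, the cost is dominated by |f| + |g| plus
      \<epsilon> times the negative part of \<phi>.\<close>
    have Cp: "integrable p C"
    proof -
      have "integrable p (\<lambda>z. max 0 (- \<phi> z))"
      proof (rule integrableI_nonneg)
        \<comment> \<open>The negative part of \<open>\<phi>\<close> is integrable for free because \<open>t * exp (- t) \<le> 1\<close>.\<close>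
        have "exp (\<phi> z) * max 0 (- \<phi> z) \<le> 1" for z
        proof -
          have "max 0 (- \<phi> z) \<le> exp (- \<phi> z)"
            using exp_ge_add_one_self[of "- \<phi> z"] exp_gt_zero[of "- \<phi> z"] by linarith
          then have "exp (\<phi> z) * max 0 (- \<phi> z) \<le> exp (\<phi> z) * exp (- \<phi> z)"
            by (rule mult_left_mono) simp
          then show ?thesis by (simp add: exp_minus)
        qed
        then have "ennreal (exp (\<phi> z)) * ennreal (max 0 (- \<phi> z)) \<le> 1" for z
          by (subst ennreal_mult'[symmetric]) (simp_all add: ennreal_le_1 del: mult_minus_right)
        then have "(\<integral>\<^sup>+ z. ennreal (max 0 (- \<phi> z)) \<partial>p) \<le> (\<integral>\<^sup>+ z. 1 \<partial>?R)"
          unfolding p_def by (subst nn_integral_density, measurable) (rule nn_integral_mono)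
        also have "\<dots> < \<infinity>" by (simp add: P.emeasure_space_1)
        finally show "(\<integral>\<^sup>+ z. ennreal (max 0 (- \<phi> z)) \<partial>p) < \<infinity>" .
      qed (auto simp: p_def)
      then have "integrable p (\<lambda>z. \<bar>f (fst z)\<bar> + \<bar>g (snd z)\<bar> + \<epsilon> * max 0 (- \<phi> z))"
        using coupling_integral_fst[OF p f] coupling_integral_snd[OF p g] by auto
      then show ?thesis
      proof (rule Bochner_Integration.integrable_bound)
        show "AE z in p. norm (C z) \<le> norm (\<bar>f (fst z)\<bar> + \<bar>g (snd z)\<bar> + \<epsilon> * max 0 (- \<phi> z))"
        proof (rule AE_I2)
          fix z
          have "- (\<epsilon> * \<phi> z) \<le> \<epsilon> * max 0 (- \<phi> z)"
            using mult_left_mono[of "- \<phi> z" "max 0 (- \<phi> z)" \<epsilon>] \<epsilon> by simp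
          moreover have "0 \<le> C z" by (simp add: C_def c0)
          ultimately show "norm (C z) \<le> norm (\<bar>f (fst z)\<bar> + \<bar>g (snd z)\<bar> + \<epsilon> * max 0 (- \<phi> z))"
            using C_eq[of z] by (simp add: abs_if)
        qed
      qed (simp add: p_def)
    qed
    have "OT (\<lambda>x y. ennreal (c x y)) \<epsilon> M N
        \<le> enn2ereal (\<integral>\<^sup>+ (x, y). ennreal (c x y) \<partial>p) + ereal \<epsilon> * KL p ?R"
      unfolding OT_def by (rule INF_lower[OF p])
    also have "KL p ?R = ereal (integral\<^sup>L p \<phi>)"
      using int\<phi>[OF p Cp] unfolding p_def
      by (intro KL_density_exp) (auto intro: P.prob_space_axioms)
    finally show "OT (\<lambda>x y. ennreal (c x y)) \<epsilon> M N \<le> ereal (integral\<^sup>L M f + integral\<^sup>L N g)"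
      using tot[OF p Cp] by (simp add: val[OF Cp])
  next
    show "ereal (integral\<^sup>L M f + integral\<^sup>L N g) \<le> OT (\<lambda>x y. ennreal (c x y)) \<epsilon> M N"
      unfolding OT_def
    proof (rule INF_greatest)
      fix \<pi> assume \<pi>: "\<pi> \<in> couplings M N"
      have s: "sets \<pi> = sets ?R" using \<pi> by (simp add: couplings_def)
      have P': "prob_space \<pi>" by (rule prob_space_coupling[OF M.prob_space_axioms \<pi>])
      show "ereal (integral\<^sup>L M f + integral\<^sup>L N g)
          \<le> enn2ereal (\<integral>\<^sup>+ (x, y). ennreal (c x y) \<partial>\<pi>) + ereal \<epsilon> * KL \<pi> ?R"
      proof (cases "integrable \<pi> C")
        case True
        have "ereal (integral\<^sup>L \<pi> \<phi>) \<le> KL \<pi> ?R"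
          using P' s int\<phi>[OF \<pi> True] one by (intro KL_ge_integral) (auto intro: P.prob_space_axioms)
        then have "ereal \<epsilon> * ereal (integral\<^sup>L \<pi> \<phi>) \<le> ereal \<epsilon> * KL \<pi> ?R"
          using \<epsilon> by (intro ereal_mult_left_mono) auto
        then have "ereal (integral\<^sup>L \<pi> C) + ereal \<epsilon> * ereal (integral\<^sup>L \<pi> \<phi>)
            \<le> ereal (integral\<^sup>L \<pi> C) + ereal \<epsilon> * KL \<pi> ?R"
          by (rule add_left_mono)
        then show ?thesis using tot[OF \<pi> True] by (simp add: val[OF True])
      next
        \<comment> \<open>A nonnegative measurable cost that is not integrable has integral
          \<infinity>, so the lower bound is trivial for such a coupling.\<close>
        case False
        have "C \<in> borel_measurable \<pi>" by (simp cong: measurable_cong_sets add: s)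
        then have "\<not> (\<integral>\<^sup>+ z. ennreal (C z) \<partial>\<pi>) < \<infinity>"
          using False integrableI_nonneg[of C \<pi>] AE_I2[of \<pi> "\<lambda>z. 0 \<le> C z"] c0
          unfolding C_def by blast
        then have "(\<integral>\<^sup>+ z. ennreal (C z) \<partial>\<pi>) = \<infinity>" by (simp add: less_top[symmetric])
        moreover have "0 \<le> KL \<pi> ?R"
          using P' s by (intro KL_nonneg) (auto intro: P.prob_space_axioms)
        then have "0 \<le> ereal \<epsilon> * KL \<pi> ?R" using \<epsilon> by auto
        then have "\<infinity> + ereal \<epsilon> * KL \<pi> ?R = \<infinity>" by simp
        ultimately show ?thesis by (simp add: C_def split_beta')
      qed
    qed
  qed
qed

section \<open>Entropic transport between centered Gaussians\<close>

text \<open>The covariance \<kappa> of the optimal plan in closed form. At a = b = v its square root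
  is the one in the denominator of the metric.\<close>

definition opt_cov :: "real \<Rightarrow> real \<Rightarrow> real \<Rightarrow> real" where
  "opt_cov \<epsilon> a b = sqrt (\<epsilon>\<^sup>2 / 16 + a * b) - \<epsilon> / 4"

lemma opt_cov_commute: "opt_cov \<epsilon> a b = opt_cov \<epsilon> b a"
  by (simp add: opt_cov_def mult.commute)

text \<open>Squaring \<kappa> + \<epsilon>/4 gives the quadratic equation for \<kappa>, doubled here
  to clear the fraction. The Gaussian computation below uses nothing else about \<kappa> but its
  positivity.\<close>

lemma opt_cov_eq:
  assumes "a > 0" "b > 0"
  shows "opt_cov \<epsilon> a b * (\<epsilon> + 2 * opt_cov \<epsilon> a b) = 2 * a * b"
proof -
  have "(sqrt (\<epsilon>\<^sup>2 / 16 + a * b))\<^sup>2 = \<epsilon>\<^sup>2 / 16 + a * b"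
    using assms by simp
  then show ?thesis by (simp add: opt_cov_def power2_eq_square algebra_simps)
qed

lemma opt_cov_pos:
  assumes "\<epsilon> > 0" "a > 0" "b > 0"
  shows "opt_cov \<epsilon> a b > 0"
proof -
  have "sqrt ((\<epsilon> / 4)\<^sup>2) < sqrt (\<epsilon>\<^sup>2 / 16 + a * b)"
    using assms by (intro real_sqrt_less_mono) (simp add: power_divide)
  then show ?thesis using assms by (simp add: opt_cov_def)
qed

text \<open>Conditioned on \<open>x\<close>, the optimal plan is Gaussian with mean \<open>\<kappa>x/a\<close> and variance \<open>\<epsilon>\<kappa>/(2a)\<close>.\<close>

lemma conditional_density:
  fixes a b \<epsilon> \<kappa> x y :: real
  assumes "\<epsilon> > 0" "a > 0" "b > 0" "\<kappa> > 0" and eq: "\<kappa> * (\<epsilon> + 2 * \<kappa>) = 2 * a * b"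
  shows "normal_density 0 (sqrt b) y * exp (((1 - \<kappa> / a) * x\<^sup>2 + (1 - \<kappa> / b) * y\<^sup>2
      - \<epsilon> / 2 * ln (\<epsilon> * \<kappa> / (2 * a * b)) - \<bar>x - y\<bar>\<^sup>2) / \<epsilon>)
    = normal_density (\<kappa> * x / a) (sqrt (\<epsilon> * \<kappa> / (2 * a))) y"
proof -
  let ?q = "\<epsilon> * \<kappa> / (2 * a * b)"
  have q: "?q > 0" using assms by simp
  \<comment> \<open>Solving the quadratic equation for b turns the comparison of exponents into a
    rational identity in \<epsilon>, a, \<kappa>, x and y.\<close>
  have b': "b = \<kappa> * (\<epsilon> + 2 * \<kappa>) / (2 * a)" using eq assms by (simp add: field_simps)
  have arg: "- (y\<^sup>2 / (2 * b)) + ((1 - \<kappa> / a) * x\<^sup>2 + (1 - \<kappa> / b) * y\<^sup>2 - (x - y)\<^sup>2) / \<epsilon>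
      = - ((y - \<kappa> * x / a)\<^sup>2 / (2 * (\<epsilon> * \<kappa> / (2 * a))))"
  proof -
    have "\<epsilon> + 2 * \<kappa> > 0" using assms by simp
    then show ?thesis using assms(1,2,4) unfolding b'
      by (simp add: divide_simps) algebra
  qed
  \<comment> \<open>\<open>?q\<close> is the ratio of the conditional variance
    \<epsilon>\<kappa>/(2a) to b. The logarithmic constant in the potentials thus contributes
    exactly the factor that corrects the normalization of the Gaussian.\<close>
  have "exp (- (ln ?q / 2)) = 1 / sqrt ?q"
    using q by (simp add: exp_minus ln_sqrt[symmetric] inverse_eq_divide)
  then have pre: "exp (u + - (ln ?q / 2)) = exp u / sqrt ?q" for u
    unfolding exp_add by simp
  have split: "((1 - \<kappa> / a) * x\<^sup>2 + (1 - \<kappa> / b) * y\<^sup>2 - \<epsilon> / 2 * ln ?q - \<bar>x - y\<bar>\<^sup>2) / \<epsilon>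
      = ((1 - \<kappa> / a) * x\<^sup>2 + (1 - \<kappa> / b) * y\<^sup>2 - (x - y)\<^sup>2) / \<epsilon> + - (ln ?q / 2)"
    using assms(1) by (simp add: field_simps)
  have "normal_density 0 (sqrt b) y * exp (((1 - \<kappa> / a) * x\<^sup>2 + (1 - \<kappa> / b) * y\<^sup>2
      - \<epsilon> / 2 * ln ?q - \<bar>x - y\<bar>\<^sup>2) / \<epsilon>)
    = 1 / (sqrt (2 * pi * b) * sqrt ?q)
      * exp (- (y\<^sup>2 / (2 * b)) + ((1 - \<kappa> / a) * x\<^sup>2 + (1 - \<kappa> / b) * y\<^sup>2 - (x - y)\<^sup>2) / \<epsilon>)"
    unfolding split pre using assms
    by (simp add: normal_density_def mult_exp_exp del: exp_minus)
  also have "\<dots> = 1 / sqrt (2 * pi * (\<epsilon> * \<kappa> / (2 * a)))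
      * exp (- ((y - \<kappa> * x / a)\<^sup>2 / (2 * (\<epsilon> * \<kappa> / (2 * a)))))"
    unfolding arg real_sqrt_mult[symmetric] using assms by simp
  finally show ?thesis using assms by (simp add: normal_density_def)
qed

text \<open>The marginal condition for the potentials: against \<open>gaussian b\<close> the
  integrand becomes a normal density in y. Everything is symmetric under exchanging (a, x) with (b,
  y), so the same fact serves both marginals.\<close>

lemma conditional_mass:
  fixes a b \<epsilon> \<kappa> x :: real
  assumes "\<epsilon> > 0" "a > 0" "b > 0" "\<kappa> > 0" "\<kappa> * (\<epsilon> + 2 * \<kappa>) = 2 * a * b"
  shows "(\<integral>\<^sup>+ y. ennreal (exp (((1 - \<kappa> / a) * x\<^sup>2 + (1 - \<kappa> / b) * y\<^sup>2
      - \<epsilon> / 2 * ln (\<epsilon> * \<kappa> / (2 * a * b)) - \<bar>x - y\<bar>\<^sup>2) / \<epsilon>)) \<partial>gaussian b) = 1"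
proof -
  let ?s = "sqrt (\<epsilon> * \<kappa> / (2 * a))"
  interpret prob_space "density lborel (\<lambda>y. ennreal (normal_density (\<kappa> * x / a) ?s y))"
    by (rule prob_space_normal_density) (use assms in simp)
  have "(\<integral>\<^sup>+ y. ennreal (normal_density (\<kappa> * x / a) ?s y) \<partial>lborel) = 1"
    using emeasure_space_1 by (simp add: emeasure_density)
  then show ?thesis
    unfolding gaussian_def conditional_density[OF assms, symmetric]
    by (subst nn_integral_density) (simp_all add: ennreal_mult')
qed

lemma gaussian_second_moment:
  assumes "a > 0"
  shows "integrable (gaussian a) (\<lambda>x. x\<^sup>2)" "(\<integral>x. x\<^sup>2 \<partial>gaussian a) = a"
proof -
  have i: "integrable lborel (\<lambda>x. normal_density 0 (sqrt a) x * (x - 0)^2)"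
    by (rule integrable_normal_moment) (simp add: assms)
  then show "integrable (gaussian a) (\<lambda>x. x\<^sup>2)"
    unfolding gaussian_def by (subst integrable_density) auto
  have "(\<integral>x. x\<^sup>2 \<partial>gaussian a) = (\<integral>x. normal_density 0 (sqrt a) x * (x - 0)^2 \<partial>lborel)"
    unfolding gaussian_def by (subst integral_density) auto
  also have "\<dots> = a"
    using integral_normal_moment_even[of "sqrt a" 0 1] assms by (simp add: numeral_2_eq_2)
  finally show "(\<integral>x. x\<^sup>2 \<partial>gaussian a) = a" .
qed

theorem OT_gaussian_eq:
  assumes "\<epsilon> > 0" "a > 0" "b > 0"
  shows "OT_gaussian \<epsilon> a b
    = a + b - 2 * opt_cov \<epsilon> a b - \<epsilon> / 2 * ln (\<epsilon> * opt_cov \<epsilon> a b / (2 * a * b))"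
proof -
  define \<kappa> where "\<kappa> = opt_cov \<epsilon> a b"
  define \<delta> where "\<delta> = \<epsilon> / 2 * ln (\<epsilon> * \<kappa> / (2 * a * b))"
  have \<kappa>: "\<kappa> > 0" "\<kappa> * (\<epsilon> + 2 * \<kappa>) = 2 * a * b" "\<kappa> * (\<epsilon> + 2 * \<kappa>) = 2 * b * a"
    using opt_cov_pos[OF assms] opt_cov_eq[OF assms(2,3)] by (simp_all add: \<kappa>_def mult_ac)
  interpret A: prob_space "gaussian a" by (rule prob_space_gaussian) fact
  interpret B: prob_space "gaussian b" by (rule prob_space_gaussian) fact
  note mom = gaussian_second_moment[OF assms(2)] gaussian_second_moment[OF assms(3)]
  \<comment> \<open>The potentials are (1 - \<kappa>/a) x^2 - \<delta> and (1 - \<kappa>/b) y^2.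
    Only their sum matters, so the whole constant \<delta> is put into the first. Their integrals
    are a - \<kappa> - \<delta> and b - \<kappa>.\<close>
  have "OT (\<lambda>x y. ennreal (\<bar>x - y\<bar>\<^sup>2)) \<epsilon> (gaussian a) (gaussian b)
    = ereal ((\<integral>x. (1 - \<kappa> / a) * x\<^sup>2 - \<delta> \<partial>gaussian a) + (\<integral>y. (1 - \<kappa> / b) * y\<^sup>2 \<partial>gaussian b))"
  proof (rule OT_eq_potentials)
    fix x :: real
    show "(\<integral>\<^sup>+ y. ennreal (exp (((1 - \<kappa> / a) * x\<^sup>2 - \<delta> + (1 - \<kappa> / b) * y\<^sup>2 - \<bar>x - y\<bar>\<^sup>2) / \<epsilon>))
        \<partial>gaussian b) = 1"
      using conditional_mass[OF assms \<kappa>(1,2), of x] by (simp add: \<delta>_def algebra_simps)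
  next
    fix y :: real
    show "(\<integral>\<^sup>+ x. ennreal (exp (((1 - \<kappa> / a) * x\<^sup>2 - \<delta> + (1 - \<kappa> / b) * y\<^sup>2 - \<bar>x - y\<bar>\<^sup>2) / \<epsilon>))
        \<partial>gaussian a) = 1"
      using conditional_mass[OF assms(1,3,2) \<kappa>(1,3), of y]
      by (simp add: \<delta>_def algebra_simps abs_minus_commute)
  qed (use assms mom in \<open>auto intro: prob_space_gaussian\<close>)
  also have "\<dots> = ereal (a + b - 2 * \<kappa> - \<delta>)"
    using assms mom A.prob_space by (simp add: algebra_simps)
  finally show ?thesis
    by (simp add: OT_gaussian_def sq_cost_def[abs_def] \<kappa>_def \<delta>_def)
qed

section \<open>Derivatives of the transport value and the metric tensor\<close>

lemma opt_cov_has_derivative: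
  assumes "a > 0" "b > 0"
  shows "((\<lambda>a. opt_cov \<epsilon> a b) has_real_derivative b / (2 * sqrt (\<epsilon>\<^sup>2 / 16 + a * b))) (at a)"
proof -
  have "\<epsilon>\<^sup>2 / 16 + a * b > 0" using assms by (simp add: add_nonneg_pos)
  then show ?thesis unfolding opt_cov_def
    by (auto intro!: derivative_eq_intros simp: field_simps)
qed

text \<open>The closed form is differentiated directly. The terms with k' add up to -k' (\<epsilon>
  + 4\<kappa>) / (2\<kappa>) = -a/\<kappa>, which the quadratic equation turns into -(\<epsilon> +
  2\<kappa>) / (2b); adding 1 + \<epsilon>/(2b) leaves 1 - \<kappa>/b.\<close>

lemma OT_gaussian_has_derivative:
  assumes "\<epsilon> > 0" "a > 0" "b > 0"
  shows "(OT_gaussian \<epsilon> a has_real_derivative 1 - opt_cov \<epsilon> a b / b) (at b)"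
proof -
  let ?k = "opt_cov \<epsilon> a b"
  define k' where "k' = a / (2 * sqrt (\<epsilon>\<^sup>2 / 16 + a * b))"
  have k: "?k > 0" by (rule opt_cov_pos[OF assms])
  have eq: "?k * (\<epsilon> + 2 * ?k) = 2 * a * b" by (rule opt_cov_eq[OF assms(2,3)])
  have dk [derivative_intros]: "(opt_cov \<epsilon> a has_real_derivative k') (at b)"
    using opt_cov_has_derivative[OF assms(3,2), of \<epsilon>]
    by (simp add: k'_def opt_cov_commute[of \<epsilon> a, abs_def] mult.commute)
  \<comment> \<open>Expressing the root through \<kappa> makes k' satisfy the equation obtained by
    differentiating the quadratic equation implicitly.\<close>
  have "sqrt (\<epsilon>\<^sup>2 / 16 + a * b) = (\<epsilon> + 4 * ?k) / 4" by (simp add: opt_cov_def)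
  then have k'eq: "k' * (\<epsilon> + 4 * ?k) = 2 * a"
    using assms(1) k unfolding k'_def by (simp only:) (simp add: field_simps)
  \<comment> \<open>The closed form with the logarithm split into summands. It agrees with
    \<open>OT_gaussian\<close> on the open half-line b > 0, which suffices to transfer the
    derivative.\<close>
  define F where "F b = a + b - 2 * opt_cov \<epsilon> a b
      - \<epsilon> / 2 * (ln \<epsilon> + ln (opt_cov \<epsilon> a b) - ln (2 * a) - ln b)" for b
  have "(F has_real_derivative 1 - 2 * k' - \<epsilon> / 2 * (k' / ?k - 1 / b)) (at b)"
    unfolding F_def using assms k
    by (auto intro!: derivative_eq_intros simp: field_simps)
  also have "1 - 2 * k' - \<epsilon> / 2 * (k' / ?k - 1 / b) = 1 - ?k / b"
  proof -
    have "k' * b * (\<epsilon> + 4 * ?k) = ?k * (\<epsilon> + 2 * ?k)"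
      using k'eq eq by algebra
    then show ?thesis using assms(3) k
      by (simp add: field_simps)
  qed
  finally have "(F has_real_derivative 1 - ?k / b) (at b)" .
  moreover have "OT_gaussian \<epsilon> a b' = F b'" if "b' \<in> {0<..}" for b'
    using that assms opt_cov_pos[of \<epsilon> a b'] OT_gaussian_eq[of \<epsilon> a b']
    by (simp add: F_def ln_div ln_mult algebra_simps)
  ultimately show ?thesis
    using assms(3) by (subst DERIV_cong_ev[OF refl _ refl])
      (auto intro!: eventually_nhds_in_open[THEN eventually_mono, of "{0<..}"])
qed

text \<open>The inner derivative is (1 - \<kappa>/v) times the speed of the path, with \<kappa>
  depending on t only through its first variance; differentiating \<kappa> in t produces the square
  root. Since \<open>deriv\<close> returns an arbitrary value where no derivative exists, the two
  differentiability claims certify that both derivatives in \<open>metric_tensor\<close> are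
  genuine.\<close>

theorem theorem6p1:
  fixes \<epsilon> :: real and v :: "real \<Rightarrow> real"
  assumes "\<epsilon> > 0"
    and "\<forall>\<^sub>F t in nhds 0. v t > 0 \<and> v differentiable at t"
  shows "(\<forall>\<^sub>F t in nhds 0. (\<lambda>s. OT_gaussian \<epsilon> (v t) (v s)) differentiable at 0)
    \<and> (\<lambda>t. deriv (\<lambda>s. OT_gaussian \<epsilon> (v t) (v s)) 0) differentiable at 0
    \<and> metric_tensor \<epsilon> v = 1 / (4 * sqrt (\<epsilon>\<^sup>2 / 16 + (v 0)\<^sup>2)) * (deriv v 0)\<^sup>2"
proof -
  have v0: "v 0 > 0" and "v differentiable at 0"
    using eventually_nhds_x_imp_x[OF assms(2)] by auto
  then have v': "(v has_real_derivative deriv v 0) (at 0)"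
    by (simp add: DERIV_deriv_iff_real_differentiable)
  have ev: "\<forall>\<^sub>F t in nhds 0. v t > 0"
    using assms(2) by eventually_elim simp
  have ds: "((\<lambda>s. OT_gaussian \<epsilon> (v t) (v s)) has_real_derivative
      (1 - opt_cov \<epsilon> (v t) (v 0) / v 0) * deriv v 0) (at 0)" if "v t > 0" for t
    using DERIV_chain2[OF OT_gaussian_has_derivative[OF assms(1) that v0] v'] .
  define c where "c = sqrt (\<epsilon>\<^sup>2 / 16 + (v 0)\<^sup>2)"
  have c: "c > 0" using v0 by (simp add: c_def add_nonneg_pos)
  have "((\<lambda>t. opt_cov \<epsilon> (v t) (v 0)) has_real_derivative v 0 / (2 * c) * deriv v 0) (at 0)"
    using DERIV_chain2[OF opt_cov_has_derivative[OF v0 v0] v', of \<epsilon>]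
    by (simp add: c_def power2_eq_square)
  \<comment> \<open>The derivative found here is minus the squared speed divided by 2c; the factor
    -1/2 of the metric tensor then gives the 4 in the denominator.\<close>
  then have "((\<lambda>t. (1 - opt_cov \<epsilon> (v t) (v 0) / v 0) * deriv v 0) has_real_derivative
      - (v 0 / (2 * c) * deriv v 0 / v 0) * deriv v 0) (at 0)"
    using v0 by (auto intro!: derivative_eq_intros)
  \<comment> \<open>The outer derivative needs the formula for the inner one on a neighbourhood of
    0, and it holds wherever the variance v t is positive.\<close>
  moreover have "\<forall>\<^sub>F t in nhds 0. deriv (\<lambda>s. OT_gaussian \<epsilon> (v t) (v s)) 0
      = (1 - opt_cov \<epsilon> (v t) (v 0) / v 0) * deriv v 0"
    using ev by eventually_elim (rule DERIV_imp_deriv[OF ds])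
  ultimately have dt: "((\<lambda>t. deriv (\<lambda>s. OT_gaussian \<epsilon> (v t) (v s)) 0) has_real_derivative
      - (v 0 / (2 * c) * deriv v 0 / v 0) * deriv v 0) (at 0)"
    by (subst DERIV_cong_ev[OF refl _ refl])
  have "metric_tensor \<epsilon> v = 1 / (4 * c) * (deriv v 0)\<^sup>2"
    unfolding metric_tensor_def DERIV_imp_deriv[OF dt]
    using v0 c by (simp add: field_simps power2_eq_square)
  moreover have "\<forall>\<^sub>F t in nhds 0. (\<lambda>s. OT_gaussian \<epsilon> (v t) (v s)) differentiable at 0"
    using ev by eventually_elim (use ds real_differentiable_def in blast)
  ultimately show ?thesis
    using dt real_differentiable_def unfolding c_def by blast
qed

end
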